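(* Let $\mathbb{D},\mathbb{D}'$ be two finite fields with $4\le|\mathbb{D}|\le|\mathbb{D}'|\le(|\mathbb{D}|-1)\lceil(|\mathbb{D}|+1)/2\rceil$, and let $m,n,m',n'\ge 2$ be integers. Suppose $\varphi:\mathbb{D}^{m\times n}\to\mathbb{D}'^{m'\times n'}$ is a degenerate graph homomorphism. Then there are two maximal sets $\mathcal{M}$ and $\mathcal{N}$ of different types containing $0$ in $\mathbb{D}'^{m'\times n'}$, and a matrix $R\in\mathbb{D}'^{m'\times n'}$, such that $$\varphi(\mathbb{D}^{m\times n})\subseteq(\mathcal{M}+R)\cup(\mathcal{N}+R).$$
   Context: $\lceil x\rceil$ is the smallest integer at least as large as $x$. Matrices $A,B\in\mathbb{D}^{m\times n}$ are adjacent, written $A\sim B$, if $\mathrm{rank}(A-B)=1$. A map $\varphi:\mathbb{D}^{m\times n}\to\mathbb{D}'^{m'\times n'}$ is a graph homomorphism if $A\sim B$ implies $\varphi(A)\sim\varphi(B)$. An adjacent set is a nonempty set of matrices any two distinct members of which are adjacent; a maximal set is an adjacent set not properly contained in any other adjacent set. Let $\mathcal{M}_1\subset\mathbb{D}^{m\times n}$ be the set of matrices supported in the first row and $\mathcal{N}_1$ the set of matrices supported in the first column. For $m,n\ge2$, every maximal set of $\mathbb{D}^{m\times n}$ is either of type one, i.e. of the form $P\mathcal{M}_1+A$ with $P\in GL_m(\mathbb{D})$, $A\in\mathbb{D}^{m\times n}$, or of type two, i.e. of the form $\mathcal{N}_1Q+A$ with $Q\in GL_n(\mathbb{D})$, $A\in\mathbb{D}^{m\times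 n}$ (and likewise over $\mathbb{D}'$). $\mathbb{D}^{m\times n}_{\le 1}=\{X\in\mathbb{D}^{m\times n}:\mathrm{rank}(X)\le 1\}$, and $\mathbb{B}_A=\mathbb{D}^{m\times n}_{\le 1}+A$. A graph homomorphism $\varphi:\mathbb{D}^{m\times n}\to\mathbb{D}'^{m'\times n'}$ is degenerate if there exist a matrix $A\in\mathbb{D}^{m\times n}_{\le 1}$ and two maximal sets $\mathcal{M},\mathcal{N}$ of different types in $\mathbb{D}'^{m'\times n'}$ such that $\varphi(\mathbb{B}_A)\subseteq\mathcal{M}\cup\mathcal{N}$ and $\varphi(A)\in\mathcal{M}\cap\mathcal{N}$. *)

theory Defs
  imports "HOL-Analysis.Analysis"
begin

text \<open>An \<open>m \<times> n\<close> matrix over a field is an element of \<open>'a ^ 'n ^ 'm\<close>, so that \<open>X $ i $ j\<close> is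
  the entry in row \<open>i :: 'm\<close> and column \<open>j :: 'n\<close>.\<close>

definition adjacent :: "'a::field ^ 'n ^ 'm \<Rightarrow> 'a ^ 'n ^ 'm \<Rightarrow> bool" where
  "adjacent A B \<longleftrightarrow> rank (A - B) = 1"

definition graph_hom :: "('a::field ^ 'n ^ 'm \<Rightarrow> 'b::field ^ 'q ^ 'p) \<Rightarrow> bool" where
  "graph_hom \<phi> \<longleftrightarrow> (\<forall>A B. adjacent A B \<longrightarrow> adjacent (\<phi> A) (\<phi> B))"

definition adjacent_set :: "('a::field ^ 'n ^ 'm) set \<Rightarrow> bool" where
  "adjacent_set S \<longleftrightarrow> S \<noteq> {} \<and> (\<forall>A\<in>S. \<forall>B\<in>S. A \<noteq> B \<longrightarrow> adjacent A B)"

definition maximal_set :: "('a::field ^ 'n ^ 'm) set \<Rightarrow> bool" where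
  "maximal_set S \<longleftrightarrow> adjacent_set S \<and> \<not> (\<exists>T. adjacent_set T \<and> S \<subset> T)"

definition translate :: "('a::field ^ 'n ^ 'm) set \<Rightarrow> 'a ^ 'n ^ 'm \<Rightarrow> ('a ^ 'n ^ 'm) set" where
  "translate S A = (\<lambda>X. X + A) ` S"

text \<open>The index types carry a linear order only to single out a first row and a first column;
  every size \<open>k \<ge> 1\<close> is the cardinality of a finite linearly ordered type.\<close>

definition first_row_matrices :: "('a::field ^ 'n ^ ('m::{finite,linorder})) set" where
  "first_row_matrices = {X. \<forall>i j. i \<noteq> Min UNIV \<longrightarrow> X $ i $ j = 0}"

definition first_column_matrices :: "('a::field ^ ('n::{finite,linorder}) ^ 'm) set" where
  "first_column_matrices = {X. \<forall>i j. j \<noteq> Min UNIV \<longrightarrow> X $ i $ j = 0}"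

definition type_one :: "('a::field ^ 'n ^ ('m::{finite,linorder})) set \<Rightarrow> bool" where
  "type_one S \<longleftrightarrow> maximal_set S \<and>
     (\<exists>(P :: 'a ^ ('m::{finite,linorder}) ^ ('m::{finite,linorder})) A. invertible P \<and>
        S = translate ((\<lambda>X. P ** X) ` first_row_matrices) A)"

definition type_two :: "('a::field ^ ('n::{finite,linorder}) ^ 'm) set \<Rightarrow> bool" where
  "type_two S \<longleftrightarrow> maximal_set S \<and>
     (\<exists>(Q :: 'a ^ ('n::{finite,linorder}) ^ ('n::{finite,linorder})) A. invertible Q \<and>
        S = translate ((\<lambda>X. X ** Q) ` first_column_matrices) A)"

definition different_types ::
    "('a::field ^ ('n::{finite,linorder}) ^ ('m::{finite,linorder})) set \<Rightarrow>
     ('a ^ ('n::{finite,linorder}) ^ ('m::{finite,linorder})) set \<Rightarrow> bool" where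
  "different_types M N \<longleftrightarrow> (type_one M \<and> type_two N) \<or> (type_two M \<and> type_one N)"

definition rank_le_one :: "('a::field ^ 'n ^ 'm) set" where
  "rank_le_one = {X. rank X \<le> 1}"

definition unit_ball :: "'a::field ^ 'n ^ 'm \<Rightarrow> ('a ^ 'n ^ 'm) set" where
  "unit_ball A = translate rank_le_one A"

text \<open>The centre \<open>A\<close> of the ball is itself required to have rank at most one.\<close>

definition degenerate ::
    "('a::field ^ 'n ^ 'm \<Rightarrow> 'b::field ^ ('q::{finite,linorder}) ^ ('p::{finite,linorder})) \<Rightarrow> bool"
  where
  "degenerate \<phi> \<longleftrightarrow> graph_hom \<phi> \<and>
     (\<exists>A\<in>rank_le_one. \<exists>M N. different_types M N \<and>
        \<phi> ` unit_ball A \<subseteq> M \<union> N \<and> \<phi> A \<in> M \<inter> N)"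

end

theory Submission
  imports Defs
begin

text \<open>Write \<open>q = |D|\<close> and \<open>q' = |D'|\<close>. Two maximal sets of different types share at most \<open>q'\<close>
  matrices. If a row set through \<open>A\<close> is mapped into \<open>M\<close>, the column sets through \<open>A\<close> in \<open>k\<close>
  given directions are mapped into \<open>N\<close>, and \<open>M\<close>, \<open>N\<close> have different types, then
  \<open>1 + k (q - 1)\<close> matrices are sent injectively into \<open>M \<inter> N\<close>, and the bound on \<open>q'\<close> forces
  \<open>2 k < q + 1\<close>. As every plane contains \<open>q + 1\<close> directions, a ball around \<open>A\<close> whose maximal sets
  through \<open>A\<close> each go into \<open>M\<close> or into \<open>N\<close> goes as a whole into one of the two. Degeneracy provides one such
  ball, with image in \<open>M\<close>, say. A neighbour of its centre lies on a row set and a column set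
  that are both mapped into \<open>M\<close>, which again makes its ball collapse into \<open>M\<close>. By connectedness
  the whole image lies in the single set \<open>M\<close>.\<close>

section \<open>Outer products and matrices of rank at most one\<close>

definition outer :: "'a::field ^ 'm \<Rightarrow> 'a ^ 'n \<Rightarrow> 'a ^ 'n ^ 'm" where
  "outer x y = (\<chi> i j. x $ i * y $ j)"

text \<open>Parametrised by a direction and a point instead of an invertible matrix. For
  \<open>x = 0\<close> the set shrinks to \<open>{A}\<close>, so nonzero directions are required
  wherever a maximal set is meant.\<close>

definition row_set :: "'a::field ^ 'm \<Rightarrow> 'a ^ 'n ^ 'm \<Rightarrow> ('a ^ 'n ^ 'm) set" where
  "row_set x A = range (\<lambda>y. A + outer x y)"

definition col_set :: "'a::field ^ 'n \<Rightarrow> 'a ^ 'n ^ 'm \<Rightarrow> ('a ^ 'n ^ 'm) set" where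
  "col_set y A = range (\<lambda>x. A + outer x y)"

text \<open>The two types of maximal sets are named by a truth value, so that \<open>b\<close> and \<open>\<not> b\<close>
  stand for opposite types and the symmetry between rows and columns needs no duplicated proofs.\<close>

definition of_kind :: "bool \<Rightarrow> ('a::field ^ 'n ^ 'm) set \<Rightarrow> bool" where
  "of_kind b M \<longleftrightarrow> (if b then \<exists>x A. x \<noteq> 0 \<and> M = row_set x A else \<exists>y A. y \<noteq> 0 \<and> M = col_set y A)"

lemma outer_nth [simp]: "outer x y $ i $ j = x $ i * y $ j"
  by (simp add: outer_def)

lemma outer_0 [simp]: "outer 0 y = 0" "outer x 0 = 0"
  by (simp_all add: vec_eq_iff)

lemma outer_eq_0_iff: "outer x y = 0 \<longleftrightarrow> x = 0 \<or> y = 0"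
  by (auto simp: vec_eq_iff)

lemma outer_scale: "outer (c *s x) y = outer x (c *s y)"
  and outer_add: "outer (x + x') y = outer x y + outer x' y"
    "outer x (y + y') = outer x y + outer x y'"
  and outer_diff: "outer (x - x') y = outer x y - outer x' y"
    "outer x (y - y') = outer x y - outer x y'"
  by (simp_all add: vec_eq_iff algebra_simps)

text \<open>A row space of dimension at most one lies in the span of one vector \<open>y\<close>,
  and the coefficients of the rows form \<open>x\<close>.\<close>

lemma rank_le_1_iff: "rank X \<le> 1 \<longleftrightarrow> (\<exists>x y. X = outer x y)" for X :: "'a::field ^ 'n ^ 'm"
proof
  assume "rank X \<le> 1"
  then have d: "vec.dim (rows X) \<le> 1" by (simp add: row_rank_def_gen)
  obtain B where B: "B \<subseteq> rows X" "vec.independent B" "rows X \<subseteq> vec.span B" "card B = vec.dim (rows X)"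
    by (rule vec.basis_exists)
  then have "finite B" "card B \<le> 1"
    using d vec.finiteI_independent by auto
  then obtain y where "B \<subseteq> {y}"
    by (metis card_le_Suc0_iff_eq One_nat_def subsetI singleton_iff)
  then have "rows X \<subseteq> vec.span {y}"
    using B(3) vec.span_mono by blast
  then have "\<forall>i. \<exists>c. X $ i = c *s y"
    by (force simp: rows_def row_def vec.span_singleton)
  then obtain f where "\<And>i. X $ i = f i *s y" by metis
  then have "X = outer (\<chi> i. f i) y" by (simp add: vec_eq_iff)
  then show "\<exists>x y. X = outer x y" by blast
next
  assume "\<exists>x y. X = outer x y"
  then obtain x y where X: "X = outer x y" by blast
  have "rows X \<subseteq> vec.span {y}"
    by (auto simp: rows_def row_def vec.span_singleton X vec_eq_iff)
  then have "vec.dim (rows X) \<le> card {y}"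
    by (intro vec.dim_le_card) auto
  then show "rank X \<le> 1" by (simp add: row_rank_def_gen)
qed

lemma rank_0_iff: "rank X = 0 \<longleftrightarrow> X = 0" for X :: "'a::field ^ 'n ^ 'm"
proof -
  have "rank X = 0 \<longleftrightarrow> rows X \<subseteq> {0}"
    by (simp add: row_rank_def_gen vec.dim_eq_0)
  also have "\<dots> \<longleftrightarrow> X = 0"
    by (auto simp: rows_def row_def vec_eq_iff subset_iff)
  finally show ?thesis .
qed

section \<open>Adjacent sets, row sets and column sets\<close>

lemma adjacent_iff: "adjacent A B \<longleftrightarrow> A \<noteq> B \<and> (\<exists>x y. A - B = outer x y)"
proof -
  have "rank (A - B) = 1 \<longleftrightarrow> rank (A - B) \<noteq> 0 \<and> rank (A - B) \<le> 1" by linarith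
  then show ?thesis by (simp only: adjacent_def rank_0_iff rank_le_1_iff right_minus_eq)
qed

lemma adjacent_setD:
  assumes "adjacent_set S" "A \<in> S" "B \<in> S"
  shows "\<exists>x y. A - B = outer x y"
proof (cases "A = B")
  case True
  then show ?thesis by (metis diff_self outer_0(1))
next
  case False
  then show ?thesis using assms by (auto simp: adjacent_set_def adjacent_iff)
qed

lemma adjacent_set_image:
  assumes "graph_hom \<phi>" "adjacent_set S"
  shows "adjacent_set (\<phi> ` S)"
  using assms unfolding adjacent_set_def graph_hom_def by (auto; metis)

text \<open>Equal matrices are never adjacent, so a homomorphism can only identify matrices that are
  not adjacent.\<close>

lemma inj_on_adjacent_set:
  assumes "graph_hom \<phi>" "adjacent_set S"
  shows "inj_on \<phi> S"
  using assms unfolding adjacent_set_def graph_hom_def inj_on_def adjacent_iff by metis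

lemma mem_row_set: "B \<in> row_set x A \<longleftrightarrow> (\<exists>y. B - A = outer x y)"
  unfolding row_set_def by (auto simp: algebra_simps)

lemma mem_col_set: "B \<in> col_set y A \<longleftrightarrow> (\<exists>x. B - A = outer x y)"
  unfolding col_set_def by (auto simp: algebra_simps)

lemma row_set_self [simp]: "A \<in> row_set x A" and col_set_self [simp]: "A \<in> col_set y A"
  unfolding mem_row_set mem_col_set by (metis diff_self outer_0)+

lemma row_set_add [simp]: "A + outer x y \<in> row_set x A"
  and col_set_add [simp]: "A + outer x y \<in> col_set y A"
  by (simp_all add: row_set_def col_set_def)

text \<open>Additivity of \<open>outer x\<close> lets any member serve as base point. Adjacency of
  two members then reduces to the case where one of them is the base point.\<close>

lemma row_set_rebase:
  assumes "B \<in> row_set x A"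
  shows "row_set x A = row_set x B"
proof -
  obtain y where y: "B - A = outer x y" using assms by (auto simp: mem_row_set)
  have "C - A = outer x z \<longleftrightarrow> C - B = outer x (z - y)" for C z
    using y by (auto simp: outer_diff algebra_simps)
  moreover have "C - B = outer x z \<longleftrightarrow> C - A = outer x (z + y)" for C z
    using y by (auto simp: outer_add algebra_simps)
  ultimately show ?thesis unfolding set_eq_iff mem_row_set by metis
qed

lemma col_set_rebase:
  assumes "B \<in> col_set y A"
  shows "col_set y A = col_set y B"
proof -
  obtain x where x: "B - A = outer x y" using assms by (auto simp: mem_col_set)
  have "C - A = outer z y \<longleftrightarrow> C - B = outer (z - x) y" for C z
    using x by (auto simp: outer_diff algebra_simps)
  moreover have "C - B = outer z y \<longleftrightarrow> C - A = outer (z + x) y" for C z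
    using x by (auto simp: outer_add algebra_simps)
  ultimately show ?thesis unfolding set_eq_iff mem_col_set by metis
qed

lemma adjacent_set_row_set: "adjacent_set (row_set x A)"
  unfolding adjacent_set_def adjacent_iff
  using row_set_self row_set_rebase mem_row_set by (metis empty_iff)

lemma adjacent_set_col_set: "adjacent_set (col_set y A)"
  unfolding adjacent_set_def adjacent_iff
  using col_set_self col_set_rebase mem_col_set by (metis empty_iff)

section \<open>Minors and proportional factors\<close>

text \<open>All \<open>2 \<times> 2\<close> minors of the pair \<open>(a, x)\<close> vanish, and a
  nonzero coordinate of \<open>x\<close> supplies the factor.\<close>

lemma proportionalI:
  assumes "x \<noteq> 0" "\<And>i j. a $ i * x $ j = a $ j * x $ i"
  shows "\<exists>c. a = c *s (x :: 'a::field ^ 'm)"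
proof -
  obtain j where "x $ j \<noteq> 0" using assms(1) by (auto simp: vec_eq_iff)
  then have "a = (a $ j / x $ j) *s x"
    using assms(2) by (simp add: vec_eq_iff field_simps)
  then show ?thesis by blast
qed

text \<open>A product of nonproportionality determinants of \<open>(a, x)\<close> and \<open>(b, y)\<close> is, up to sign, a
  \<open>2 \<times> 2\<close> minor of \<open>outer a b - outer x y\<close>.\<close>

lemma outer_diff_rank_one:
  assumes "x \<noteq> 0" "y \<noteq> 0" "outer a b - outer x y = outer c d"
  shows "(\<exists>k. a = k *s x) \<or> (\<exists>k. b = k *s y)"
proof (rule ccontr)
  assume "\<not> ?thesis"
  then obtain i j k l where n: "a $ i * x $ j \<noteq> a $ j * x $ i" "b $ k * y $ l \<noteq> b $ l * y $ k"
    using proportionalI assms(1,2) by metis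
  have e: "a $ r * b $ s - x $ r * y $ s = c $ r * d $ s" for r s
    using arg_cong[OF assms(3), of "\<lambda>X. X $ r $ s"] by simp
  \<comment> \<open>The minor of \<open>outer c d\<close> in rows \<open>i\<close>, \<open>j\<close>
    and columns \<open>k\<close>, \<open>l\<close> vanishes; expanded in \<open>a\<close>,
    \<open>b\<close>, \<open>x\<close>, \<open>y\<close> it factors into the two
    determinants.\<close>
  have "(a $ i * b $ k - x $ i * y $ k) * (a $ j * b $ l - x $ j * y $ l) =
        (a $ i * b $ l - x $ i * y $ l) * (a $ j * b $ k - x $ j * y $ k)"
    unfolding e by simp
  then have "(a $ i * x $ j - a $ j * x $ i) * (b $ k * y $ l - b $ l * y $ k) = 0"
    by algebra
  with n show False by simp
qed

text \<open>For the first factors compare entries within a column where \<open>b\<close> does not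
  vanish, for the second factors entries within a row where \<open>a\<close> does not
  vanish.\<close>

lemma outer_eq_outer:
  assumes "outer x y \<noteq> 0" "outer a b = outer x y"
  shows "\<exists>k. a = k *s x" "\<exists>k. b = k *s y"
proof -
  have n: "x \<noteq> 0" "y \<noteq> 0" using assms(1) by (auto simp: outer_eq_0_iff)
  then obtain i j where ij: "x $ i \<noteq> 0" "y $ j \<noteq> 0" by (auto simp: vec_eq_iff)
  have e: "a $ r * b $ s = x $ r * y $ s" for r s
    using arg_cong[OF assms(2), of "\<lambda>X. X $ r $ s"] by simp
  have "a $ i \<noteq> 0" "b $ j \<noteq> 0" using e[of i j] ij by auto
  have "a $ r * x $ s * b $ j = a $ s * x $ r * b $ j" for r s
    using e[of r j] e[of s j] by algebra
  with \<open>b $ j \<noteq> 0\<close> show "\<exists>k. a = k *s x" by (intro proportionalI n) simp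
  have "b $ r * y $ s * a $ i = b $ s * y $ r * a $ i" for r s
    using e[of i r] e[of i s] by algebra
  with \<open>a $ i \<noteq> 0\<close> show "\<exists>k. b = k *s y" by (intro proportionalI n) simp
qed

section \<open>How adjacent sets meet maximal sets\<close>

text \<open>A member outside the row set and one outside the column set would differ by
  \<open>outer a y - outer x b\<close> with neither pair of factors proportional, hence by rank
  two.\<close>

lemma adjacent_set_in_row_or_col:
  assumes K: "adjacent_set K" and "x \<noteq> 0" "y \<noteq> 0"
    and sub: "K \<subseteq> row_set x P \<union> col_set y P"
  shows "K \<subseteq> row_set x P \<or> K \<subseteq> col_set y P"
proof (rule ccontr)
  assume "\<not> ?thesis"
  then obtain Y Z where Y: "Y \<in> K" "Y \<notin> row_set x P" and Z: "Z \<in> K" "Z \<notin> col_set y P" by blast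
  then obtain a b where a: "Y - P = outer a y" and b: "Z - P = outer x b"
    using sub by (metis (no_types) UnE mem_col_set mem_row_set subsetD)
  obtain c d where "Y - Z = outer c d" using adjacent_setD[OF K Y(1) Z(1)] by blast
  then have "outer a y - outer x b = outer c d" using a b by (metis diff_diff_eq2 diff_add_cancel)
  moreover have "b \<noteq> 0" using b Z(2) mem_col_set by (metis outer_0)
  ultimately have "(\<exists>k. a = k *s x) \<or> (\<exists>k. y = k *s b)"
    using outer_diff_rank_one \<open>x \<noteq> 0\<close> by blast
  then show False
  proof
    assume "\<exists>k. a = k *s x"
    then show False using a Y(2) unfolding mem_row_set by (metis outer_scale)
  next
    assume "\<exists>k. y = k *s b"
    then obtain k where k: "y = k *s b" by blast
    with \<open>y \<noteq> 0\<close> have "b = inverse k *s y" by (auto simp: vec_eq_iff)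
    then show False using b Z(2) unfolding mem_col_set by (metis outer_scale)
  qed
qed

lemma of_kind_cases:
  assumes "of_kind b M" "P \<in> M"
  obtains (row) x where "b" "x \<noteq> 0" "M = row_set x P" | (col) y where "\<not> b" "y \<noteq> 0" "M = col_set y P"
proof (cases b)
  case True
  then obtain x A where "x \<noteq> 0" "M = row_set x A" using assms by (auto simp: of_kind_def)
  then show ?thesis using row True assms(2) row_set_rebase by blast
next
  case False
  then obtain y A where "y \<noteq> 0" "M = col_set y A" using assms by (auto simp: of_kind_def)
  then show ?thesis using col False assms(2) col_set_rebase by blast
qed

text \<open>Rebasing both sets at their common point \<open>P\<close> turns them into a row set and
  a column set with the same base.\<close>

lemma adjacent_set_in_union:
  assumes "adjacent_set K" "of_kind b M" "of_kind (\<not> b) N" "K \<subseteq> M \<union> N" "P \<in> M" "P \<in> N"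
  shows "K \<subseteq> M \<or> K \<subseteq> N"
  using assms(2,5)
proof (cases rule: of_kind_cases)
  case (row x)
  with assms(3,6) obtain y where "y \<noteq> 0" "N = col_set y P" by (auto elim: of_kind_cases)
  with row assms show ?thesis using adjacent_set_in_row_or_col by blast
next
  case (col y)
  with assms(3,6) obtain x where "x \<noteq> 0" "N = row_set x P" by (auto elim: of_kind_cases)
  with col assms show ?thesis using adjacent_set_in_row_or_col[of K x y P] by blast
qed

text \<open>If a further member is \<open>P + outer a b\<close>, its difference from
  \<open>Q\<close> has rank at most one, so \<open>a\<close> is a multiple of \<open>x\<close> or
  \<open>b\<close> one of \<open>y\<close>. Hence \<open>K\<close> lies in the union, and adjacency
  selects one part.\<close>

lemma adjacent_set_through_two_points:
  assumes K: "adjacent_set K" and "P \<in> K" "Q \<in> K" "Q - P = outer x y" "Q \<noteq> P"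
  shows "K \<subseteq> row_set x P \<or> K \<subseteq> col_set y P"
proof -
  have n: "x \<noteq> 0" "y \<noteq> 0" using assms(4,5) by auto
  have "Z \<in> row_set x P \<union> col_set y P" if Z: "Z \<in> K" for Z
  proof -
    obtain a b c d where ab: "Z - P = outer a b" and cd: "Z - Q = outer c d"
      using adjacent_setD[OF K Z] assms(2,3) by metis
    then have "outer a b - outer x y = outer c d"
      using assms(4) by (metis diff_diff_eq2 diff_add_cancel)
    then consider k where "a = k *s x" | k where "b = k *s y"
      using outer_diff_rank_one n by blast
    then show ?thesis
      using ab unfolding Un_iff mem_row_set mem_col_set by cases (metis outer_scale)+
  qed
  then show ?thesis using adjacent_set_in_row_or_col[OF K n] by blast
qed

text \<open>Two adjacent matrices determine one row set and one column set; one of these is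
  \<open>M\<close>, and the other serves as \<open>N\<close>.\<close>

lemma adjacent_set_meets_twice:
  assumes K: "adjacent_set K" and M: "of_kind b M"
    and PQ: "P \<in> K" "Q \<in> K" "P \<in> M" "Q \<in> M" "Q \<noteq> P"
  shows "K \<subseteq> M \<or> (\<exists>N. of_kind (\<not> b) N \<and> K \<subseteq> N)"
  using M PQ(3)
proof (cases rule: of_kind_cases)
  case (row x)
  then obtain y where y: "Q - P = outer x y" using PQ by (auto simp: mem_row_set)
  then have "y \<noteq> 0" using PQ by auto
  then have "of_kind (\<not> b) (col_set y P)" using row by (auto simp: of_kind_def)
  then show ?thesis using adjacent_set_through_two_points[OF K _ _ y] PQ row by blast
next
  case (col y)
  then obtain x where x: "Q - P = outer x y" using PQ by (auto simp: mem_col_set)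
  then have "x \<noteq> 0" using PQ by auto
  then have "of_kind (\<not> b) (row_set x P)" using col by (auto simp: of_kind_def)
  then show ?thesis using adjacent_set_through_two_points[OF K _ _ x] PQ col by blast
qed

lemma row_set_scale:
  assumes "k \<noteq> 0"
  shows "row_set (k *s x) A = row_set x A"
proof -
  have "outer x z = outer (k *s x) (inverse k *s z)" for z
    using assms by (simp add: vec_eq_iff)
  then show ?thesis unfolding set_eq_iff mem_row_set by (metis outer_scale)
qed

lemma col_set_scale:
  assumes "k \<noteq> 0"
  shows "col_set (k *s x) A = col_set x A"
proof -
  have "outer z x = outer (inverse k *s z) (k *s x)" for z
    using assms by (simp add: vec_eq_iff)
  then show ?thesis unfolding set_eq_iff mem_col_set by (metis outer_scale)
qed

text \<open>The nonzero difference of the two common points fixes the direction up to a nonzero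
  scalar.\<close>

lemma of_kind_eqI:
  assumes "of_kind b M" "of_kind b N" "P \<in> M" "P \<in> N" "Q \<in> M" "Q \<in> N" "Q \<noteq> P"
  shows "M = N"
  using assms(1,3)
proof (cases rule: of_kind_cases)
  case (row x)
  with assms(2,4) obtain x' where N: "N = row_set x' P" by (auto elim: of_kind_cases)
  then obtain y y' where y: "Q - P = outer x y" "Q - P = outer x' y'"
    using row assms mem_row_set by metis
  with assms(7) have n: "outer x y \<noteq> 0" by (metis right_minus_eq)
  with y obtain k where k: "x' = k *s x" using outer_eq_outer by metis
  moreover from k n y have "k \<noteq> 0" by auto
  ultimately show ?thesis using row N row_set_scale by metis
next
  case (col x)
  with assms(2,4) obtain x' where N: "N = col_set x' P" by (auto elim: of_kind_cases)
  then obtain y y' where y: "Q - P = outer y x" "Q - P = outer y' x'"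
    using col assms mem_col_set by metis
  with assms(7) have n: "outer y x \<noteq> 0" by (metis right_minus_eq)
  with y obtain k where k: "x' = k *s x" using outer_eq_outer by metis
  moreover from k n y have "k \<noteq> 0" by auto
  ultimately show ?thesis using col N col_set_scale by metis
qed

text \<open>A nonempty intersection is contained in the affine line
  \<open>P + outer (c *s x) y\<close>, parametrised by the scalar \<open>c\<close>.\<close>

lemma card_of_kind_inter:
  fixes M N :: "('a::{field,finite} ^ 'n ^ 'm) set"
  assumes "of_kind b M" "of_kind (\<not> b) N"
  shows "card (M \<inter> N) \<le> CARD('a)"
proof (cases "M \<inter> N = {}")
  case False
  then obtain P where P: "P \<in> M" "P \<in> N" by blast
  obtain x y where n: "x \<noteq> 0" "y \<noteq> 0" and MN: "M \<inter> N = row_set x P \<inter> col_set y P"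
    using assms P by (elim of_kind_cases) auto
  have "Z \<in> range (\<lambda>c. P + outer (c *s x) y)" if "Z \<in> row_set x P \<inter> col_set y P" for Z
  proof -
    from that obtain a b where ab: "Z - P = outer x b" "Z - P = outer a y"
      by (auto simp: mem_row_set mem_col_set)
    have "\<exists>c. Z - P = outer (c *s x) y"
    proof (cases "outer x b = 0")
      case True
      then have "Z - P = outer (0 *s x) y" using ab by simp
      then show ?thesis by blast
    next
      case False
      with ab outer_eq_outer[of x b a y] obtain k where k: "y = k *s b" by metis
      with n have "b = inverse k *s y" by (auto simp: vec_eq_iff)
      then show ?thesis using ab outer_scale by metis
    qed
    then show ?thesis by (auto simp: algebra_simps)
  qed
  then have "card (M \<inter> N) \<le> card (range (\<lambda>c. P + outer (c *s x) y))"
    unfolding MN by (intro card_mono) auto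
  also have "\<dots> \<le> CARD('a)" by (rule card_image_le) simp
  finally show ?thesis .
qed simp


section \<open>Unit balls and their covers\<close>

lemma mem_unit_ball: "X \<in> unit_ball A \<longleftrightarrow> (\<exists>x y. X - A = outer x y)"
proof -
  have "X \<in> unit_ball A \<longleftrightarrow> rank (X - A) \<le> 1"
    unfolding unit_ball_def translate_def rank_le_one_def image_iff
    by (metis (no_types, lifting) add_diff_cancel_right' diff_add_cancel mem_Collect_eq)
  then show ?thesis by (simp only: rank_le_1_iff)
qed

lemma row_set_subset_unit_ball: "row_set x A \<subseteq> unit_ball A"
  and col_set_subset_unit_ball: "col_set y A \<subseteq> unit_ball A"
  unfolding subset_iff mem_unit_ball mem_row_set mem_col_set by blast+

lemma exists_nonzero: "\<exists>w. w \<noteq> (0 :: 'a::field ^ 'n)"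
  by (metis axis_eq_0_iff zero_neq_one)

text \<open>The row sets in nonzero directions cover the ball. The vector \<open>w\<close> handles
  the centre, where the factor \<open>x\<close> may vanish and name no direction.\<close>

lemma image_unit_ball_row_sets:
  fixes A :: "'a::field ^ 'n ^ 'm"
  assumes "\<And>w. w \<noteq> 0 \<Longrightarrow> \<phi> ` row_set w A \<subseteq> M"
  shows "\<phi> ` unit_ball A \<subseteq> M"
proof clarify
  fix X assume "X \<in> unit_ball A"
  then obtain x y where xy: "X - A = outer x y" by (auto simp: mem_unit_ball)
  obtain w :: "'a ^ 'm" where "w \<noteq> 0" using exists_nonzero by blast
  show "\<phi> X \<in> M"
  proof (cases "x = 0")
    case True
    then have "X = A" using xy by simp
    then show ?thesis using assms[OF \<open>w \<noteq> 0\<close>] by auto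
  next
    case False
    moreover have "X \<in> row_set x A" using xy by (auto simp: mem_row_set)
    ultimately show ?thesis using assms by blast
  qed
qed

lemma image_unit_ball_col_sets:
  fixes A :: "'a::field ^ 'n ^ 'm"
  assumes "\<And>w. w \<noteq> 0 \<Longrightarrow> \<phi> ` col_set w A \<subseteq> M"
  shows "\<phi> ` unit_ball A \<subseteq> M"
proof clarify
  fix X assume "X \<in> unit_ball A"
  then obtain x y where xy: "X - A = outer x y" by (auto simp: mem_unit_ball)
  obtain w :: "'a ^ 'n" where "w \<noteq> 0" using exists_nonzero by blast
  show "\<phi> X \<in> M"
  proof (cases "y = 0")
    case True
    then have "X = A" using xy by simp
    then show ?thesis using assms[OF \<open>w \<noteq> 0\<close>] by auto
  next
    case False
    moreover have "X \<in> col_set y A" using xy by (auto simp: mem_col_set)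
    ultimately show ?thesis using assms by blast
  qed
qed

text \<open>The \<open>q + 1\<close> points of the projective line spanned by two coordinate vectors; \<open>None\<close> is the
  point at infinity.\<close>

definition direction :: "'n \<Rightarrow> 'n \<Rightarrow> 'a option \<Rightarrow> 'a::field ^ 'n" where
  "direction i j t = (case t of None \<Rightarrow> axis j 1 | Some c \<Rightarrow> axis i 1 + axis j c)"

lemma direction_nonzero: "i \<noteq> j \<Longrightarrow> direction i j t \<noteq> 0" for t :: "'a::field option"
  by (cases t) (auto simp: direction_def vec_eq_iff axis_def)

text \<open>The representatives are normalised, so coordinates \<open>i\<close> and \<open>j\<close>
  recover both scalar and point. This keeps the later count free of repetitions.\<close>

lemma direction_inj:
  assumes "i \<noteq> j" "a \<noteq> 0" "b \<noteq> 0" "a *s direction i j t = b *s direction i j t'"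
  shows "a = b \<and> t = t'"
proof -
  have "a * direction i j t $ k = b * direction i j t' $ k" for k
    using arg_cong[OF assms(4), of "\<lambda>x. x $ k"] by simp
  from this[of i] this[of j] show ?thesis
    using assms(1-3) by (cases t; cases t') (auto simp: direction_def axis_def)
qed

section \<open>Counting directions and collapsing balls\<close>

text \<open>\<open>small\<close> is the bound that limits crossing directions; \<open>wide\<close>
  provides two coordinates spanning a plane of column directions.\<close>

locale small_hom =
  fixes \<phi> :: "'a::{field,finite} ^ 'n ^ 'm \<Rightarrow> 'b::{field,finite} ^ 'q ^ 'p"
  assumes hom: "graph_hom \<phi>"
    and small: "int CARD('b) \<le> (int CARD('a) - 1) * \<lceil>(real CARD('a) + 1) / 2\<rceil>"
    and wide: "CARD('n) \<ge> 2"
begin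

lemma few_crossing_directions:
  assumes "i \<noteq> j" "u \<noteq> 0" "of_kind b M" "of_kind (\<not> b) N" "\<phi> ` row_set u A \<subseteq> M"
    and T: "\<And>t. t \<in> T \<Longrightarrow> \<phi> ` col_set (direction i j t) A \<subseteq> N" and "T \<noteq> {}"
  shows "2 * card T < CARD('a) + 1"
proof -
  \<comment> \<open>\<open>g\<close> enumerates on \<open>D\<close> the matrices other than
    \<open>A\<close> that the row set of \<open>u\<close> shares with the column sets in the
    directions of \<open>T\<close>.\<close>
  define g where "g = (\<lambda>(t, c). A + outer u (c *s direction i j t))"
  define D where "D = T \<times> (UNIV - {0 :: 'a})"
  have inj: "inj_on g D"
  proof (rule inj_onI)
    fix p p' assume "p \<in> D" "p' \<in> D" and eq: "g p = g p'"
    then obtain t c t' c' where p: "p = (t, c)" "p' = (t', c')" and c: "c \<noteq> 0" "c' \<noteq> 0"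
      by (auto simp: D_def)
    have "outer u (c *s direction i j t - c' *s direction i j t') = 0"
      using eq by (simp add: p g_def outer_diff)
    then have "c *s direction i j t = c' *s direction i j t'"
      using \<open>u \<noteq> 0\<close> by (simp add: outer_eq_0_iff)
    then show "p = p'"
      using direction_inj \<open>i \<noteq> j\<close> c p by blast
  qed
  have "A \<notin> g ` D"
    using \<open>u \<noteq> 0\<close> direction_nonzero[OF \<open>i \<noteq> j\<close>, where 'a = 'a]
    by (auto simp: g_def D_def outer_eq_0_iff)
  moreover have "card D = card T * (CARD('a) - 1)"
    by (simp add: D_def card_cartesian_product card_Diff_singleton)
  ultimately have "card (insert A (g ` D)) = 1 + card T * (CARD('a) - 1)"
    by (simp add: card_image[OF inj])
  moreover have "insert A (g ` D) \<subseteq> row_set u A"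
    by (auto simp: g_def)
  then have "card (insert A (g ` D)) = card (\<phi> ` insert A (g ` D))"
    using inj_on_adjacent_set[OF hom adjacent_set_row_set] by (metis card_image inj_on_subset)
  moreover have "\<phi> ` insert A (g ` D) \<subseteq> M \<inter> N"
  proof -
    have "\<phi> X \<in> N" if X: "X \<in> insert A (g ` D)" for X
    proof -
      have "\<exists>t\<in>T. X \<in> col_set (direction i j t) A"
      proof (cases "X = A")
        case True
        \<comment> \<open>The centre lies on every column set, so a single direction in
          \<open>T\<close> suffices.\<close>
        then show ?thesis using \<open>T \<noteq> {}\<close> col_set_self by blast
      next
        case False
        then obtain t c where "t \<in> T" "X = A + outer (c *s u) (direction i j t)"
          using X by (auto simp: g_def D_def outer_scale)
        then show ?thesis using col_set_add by blast
      qed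
      then show ?thesis using T by blast
    qed
    then show ?thesis
      using \<open>insert A (g ` D) \<subseteq> row_set u A\<close> assms(5) by blast
  qed
  then have "card (\<phi> ` insert A (g ` D)) \<le> CARD('b)"
    using card_of_kind_inter[OF assms(3,4)] card_mono[of "M \<inter> N"] by (metis finite le_trans)
  ultimately have "1 + card T * (CARD('a) - 1) \<le> CARD('b)" by simp
  then have "int (1 + card T * (CARD('a) - 1)) \<le> int CARD('b)"
    by (simp only: of_nat_le_iff)
  then have "1 + int (card T) * (int CARD('a) - 1) \<le> int CARD('b)"
    by (simp add: of_nat_diff Suc_leI)
  \<comment> \<open>The \<open>1\<close> contributed by the centre makes this inequality
    strict.\<close>
  with small have "int (card T) * (int CARD('a) - 1) < \<lceil>(real CARD('a) + 1) / 2\<rceil> * (int CARD('a) - 1)"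
    by (simp add: mult.commute)
  moreover have "0 \<le> int CARD('a) - 1"
    by (simp add: Suc_leI)
  ultimately have "int (card T) < \<lceil>(real CARD('a) + 1) / 2\<rceil>"
    by (rule mult_right_less_imp_less)
  \<comment> \<open>An integer is below a ceiling exactly when it is below the number
    itself.\<close>
  then have "real (card T) < (real CARD('a) + 1) / 2"
    by (simp add: less_ceiling_iff)
  then have "real (2 * card T) < real (CARD('a) + 1)" by simp
  then show ?thesis by (simp only: of_nat_less_iff)
qed

text \<open>One of \<open>M\<close> and \<open>N\<close> receives the column sets of at least half
  of the \<open>q + 1\<close> directions. Then no row set can go into the other one, so all row sets
  go into the same set.\<close>

lemma image_unit_ball_dichotomy:
  assumes "of_kind b M" "of_kind (\<not> b) N"
    and rows: "\<And>w. w \<noteq> 0 \<Longrightarrow> \<phi> ` row_set w A \<subseteq> M \<or> \<phi> ` row_set w A \<subseteq> N"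
    and cols: "\<And>w. w \<noteq> 0 \<Longrightarrow> \<phi> ` col_set w A \<subseteq> M \<or> \<phi> ` col_set w A \<subseteq> N"
  shows "\<phi> ` unit_ball A \<subseteq> M \<or> \<phi> ` unit_ball A \<subseteq> N"
proof -
  obtain i j :: 'n where "i \<noteq> j"
    using wide by (metis card_le_Suc0_iff_eq UNIV_I finite not_less_eq_eq numeral_2_eq_2)
  define T where "T S = {t. \<phi> ` col_set (direction i j t) A \<subseteq> S}" for S
  have no_row: "\<not> \<phi> ` row_set w A \<subseteq> X"
    if "of_kind k X" "of_kind (\<not> k) Y" "CARD('a) + 1 \<le> 2 * card (T Y)" "w \<noteq> 0" for k X Y w
  proof
    assume "\<phi> ` row_set w A \<subseteq> X"
    moreover have "T Y \<noteq> {}" using that(3) by auto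
    ultimately have "2 * card (T Y) < CARD('a) + 1"
      using \<open>i \<noteq> j\<close> that(1,2,4) by (intro few_crossing_directions) (auto simp: T_def)
    with that(3) show False by simp
  qed
  have "T M \<union> T N = UNIV"
    using cols direction_nonzero[OF \<open>i \<noteq> j\<close>, where 'a = 'a] by (auto simp: T_def)
  then have "CARD('a option) \<le> card (T M) + card (T N)"
    by (metis card_Un_le)
  then have "CARD('a) + 1 \<le> card (T M) + card (T N)"
    by (simp add: card_UNIV_option)
  then consider "CARD('a) + 1 \<le> 2 * card (T M)" | "CARD('a) + 1 \<le> 2 * card (T N)"
    by linarith
  then show ?thesis
  proof cases
    case 1
    then show ?thesis
      using rows no_row[of "\<not> b" N M] assms(1,2) image_unit_ball_row_sets[of \<phi> A M] by auto
  next
    case 2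
    then show ?thesis
      using rows no_row[of b M N] assms(1,2) image_unit_ball_row_sets[of \<phi> A N] by auto
  qed
qed

text \<open>Every row set through \<open>A\<close> shares a second matrix with the column set of
  \<open>v\<close>, and every column set with the row set of \<open>u\<close>. Its image thus meets
  \<open>M\<close> twice and goes into \<open>M\<close> or into an exceptional set of the opposite
  type.\<close>

lemma image_unit_ball_subset:
  assumes M: "of_kind b M" and "u \<noteq> 0" "v \<noteq> 0"
    and u: "\<phi> ` row_set u A \<subseteq> M" and v: "\<phi> ` col_set v A \<subseteq> M"
  shows "\<phi> ` unit_ball A \<subseteq> M"
proof -
  have row: "adjacent_set (\<phi> ` row_set w A)" and col: "adjacent_set (\<phi> ` col_set w' A)" for w w'
    by (simp_all add: adjacent_set_image hom adjacent_set_row_set adjacent_set_col_set)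
  have ne: "\<phi> (A + outer x y) \<noteq> \<phi> A" if "x \<noteq> 0" "y \<noteq> 0" for x y
  proof -
    have "adjacent (A + outer x y) A"
      using that by (auto simp: adjacent_iff outer_eq_0_iff)
    then show ?thesis using hom by (auto simp: graph_hom_def adjacent_iff)
  qed
  have mem: "\<phi> (A + outer x y) \<in> \<phi> ` row_set x A" "\<phi> (A + outer x y) \<in> \<phi> ` col_set y A"
    for x y
    by simp_all
  have self: "\<phi> A \<in> \<phi> ` row_set x A" "\<phi> A \<in> \<phi> ` col_set y A" for x y
    by simp_all
  have rows: "\<phi> ` row_set w A \<subseteq> M \<or> (\<exists>N. of_kind (\<not> b) N \<and> \<phi> ` row_set w A \<subseteq> N)" if "w \<noteq> 0" for w
    using adjacent_set_meets_twice[OF row[of w] M, of "\<phi> A" "\<phi> (A + outer w v)"]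
      mem[of w v] self ne[OF that \<open>v \<noteq> 0\<close>] v by blast
  have cols: "\<phi> ` col_set w A \<subseteq> M \<or> (\<exists>N. of_kind (\<not> b) N \<and> \<phi> ` col_set w A \<subseteq> N)" if "w \<noteq> 0" for w
    using adjacent_set_meets_twice[OF col[of w] M, of "\<phi> A" "\<phi> (A + outer u w)"]
      mem[of u w] self ne[OF \<open>u \<noteq> 0\<close> that] u by blast
  \<comment> \<open>A row set and a column set through \<open>A\<close> also share
    \<open>A + outer x y\<close>, so their exceptional sets have two common points.\<close>
  have eq: "N = N'" if "of_kind (\<not> b) N" "of_kind (\<not> b) N'" "x \<noteq> 0" "y \<noteq> 0"
    "\<phi> ` row_set x A \<subseteq> N" "\<phi> ` col_set y A \<subseteq> N'" for N N' x y
    using of_kind_eqI[OF that(1,2), of "\<phi> A" "\<phi> (A + outer x y)"] mem[of x y] self ne[OF that(3,4)] that(5,6)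
    by blast
  show ?thesis
  proof (cases "(\<forall>w. w \<noteq> 0 \<longrightarrow> \<phi> ` row_set w A \<subseteq> M) \<or> (\<forall>w. w \<noteq> 0 \<longrightarrow> \<phi> ` col_set w A \<subseteq> M)")
    case True
    then show ?thesis using image_unit_ball_row_sets[of \<phi> A M] image_unit_ball_col_sets[of \<phi> A M] by blast
  next
    case False
    \<comment> \<open>One exceptional row set and one exceptional column set are both needed: each
      identifies the exceptional sets of the other family with \<open>N\<close>.\<close>
    then obtain x y N N' where xy: "x \<noteq> 0" "y \<noteq> 0" and N: "of_kind (\<not> b) N" "of_kind (\<not> b) N'"
      "\<phi> ` row_set x A \<subseteq> N" "\<phi> ` col_set y A \<subseteq> N'"
      using rows cols by meson
    then have "N' = N" using eq by blast
    with N have y: "\<phi> ` col_set y A \<subseteq> N" by simp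
    have "\<phi> ` row_set w A \<subseteq> M \<or> \<phi> ` row_set w A \<subseteq> N" if "w \<noteq> 0" for w
    using rows[OF that]
    proof
      assume "\<exists>N'. of_kind (\<not> b) N' \<and> \<phi> ` row_set w A \<subseteq> N'"
      then obtain N' where "of_kind (\<not> b) N'" "\<phi> ` row_set w A \<subseteq> N'" by blast
      with eq[OF _ N(1) that xy(2) _ y] show ?thesis by auto
    qed simp
    moreover have "\<phi> ` col_set w A \<subseteq> M \<or> \<phi> ` col_set w A \<subseteq> N" if "w \<noteq> 0" for w
    using cols[OF that]
    proof
      assume "\<exists>N'. of_kind (\<not> b) N' \<and> \<phi> ` col_set w A \<subseteq> N'"
      then obtain N' where "of_kind (\<not> b) N'" "\<phi> ` col_set w A \<subseteq> N'" by blast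
      with eq[OF N(1) _ xy(1) that N(3)] show ?thesis by auto
    qed simp
    ultimately have "\<phi> ` unit_ball A \<subseteq> M \<or> \<phi> ` unit_ball A \<subseteq> N"
      by (intro image_unit_ball_dichotomy[OF M N(1)])
    then show ?thesis
    proof
      assume ball: "\<phi> ` unit_ball A \<subseteq> N"
      obtain i j :: 'n where ij: "i \<noteq> j"
        using wide by (metis card_le_Suc0_iff_eq UNIV_I finite not_less_eq_eq numeral_2_eq_2)
      have "\<phi> ` col_set w A \<subseteq> N" for w
        using col_set_subset_unit_ball ball by blast
      \<comment> \<open>All \<open>q + 1\<close> directions would cross the row set of
        \<open>u\<close>, which stays in \<open>M\<close>, against the bound of fewer than half of
        them.\<close>
      then have "2 * CARD('a option) < CARD('a) + 1"
        by (intro few_crossing_directions[OF ij \<open>u \<noteq> 0\<close> M N(1) u]) auto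
      then show ?thesis by (simp add: card_UNIV_option)
    qed simp
  qed
qed

text \<open>The row set of \<open>x\<close> and the column set of \<open>y\<close> through the new
  centre already pass through \<open>A\<close>, so they lie in the old ball.\<close>

lemma image_unit_ball_step:
  assumes M: "of_kind b M" and A: "\<phi> ` unit_ball A \<subseteq> M"
  shows "\<phi> ` unit_ball (A + outer x y) \<subseteq> M"
proof (cases "x = 0 \<or> y = 0")
  case True
  then show ?thesis using A by auto
next
  case False
  have "row_set x (A + outer x y) = row_set x A" "col_set y (A + outer x y) = col_set y A"
    using row_set_rebase row_set_add col_set_rebase col_set_add by blast+
  then have "\<phi> ` row_set x (A + outer x y) \<subseteq> M" "\<phi> ` col_set y (A + outer x y) \<subseteq> M"
    using A row_set_subset_unit_ball[of x A] col_set_subset_unit_ball[of y A] by (simp_all, blast+)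
  then show ?thesis using image_unit_ball_subset[OF M] False by blast
qed

text \<open>Any \<open>X\<close> is reached from \<open>A\<close> by correcting one row at a time,
  and each correction has rank at most one.\<close>

lemma range_subset:
  assumes M: "of_kind b M" and A: "\<phi> ` unit_ball A \<subseteq> M"
  shows "range \<phi> \<subseteq> M"
proof clarify
  fix X :: "'a ^ 'n ^ 'm"
  have ball: "\<phi> ` unit_ball (A + (\<Sum>i\<in>S. outer (axis i 1) ((X - A) $ i))) \<subseteq> M" if "finite S" for S
    using that
  proof induction
    case (insert i S)
    then show ?case
      using image_unit_ball_step[OF M insert.IH] by (simp add: add_ac)
  qed (use A in simp)
  have "(\<Sum>i\<in>UNIV. outer (axis i 1) ((X - A) $ i)) = X - A"
  proof -
    have "(\<Sum>i\<in>UNIV. outer (axis i 1) ((X - A) $ i)) $ k $ l = (\<Sum>i\<in>UNIV. if i = k then (X - A) $ k $ l else 0)"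
      for k l
      unfolding sum_component by (rule sum.cong) (auto simp: axis_def)
    then show ?thesis by (simp add: vec_eq_iff)
  qed
  with ball[of UNIV] have "\<phi> ` unit_ball X \<subseteq> M" by simp
  moreover have "X \<in> unit_ball X"
    using row_set_self row_set_subset_unit_ball by blast
  ultimately show "\<phi> X \<in> M" by blast
qed

end

section \<open>Types of maximal sets as row and column sets\<close>

text \<open>Only the first column of \<open>P\<close> acts on a matrix supported in the first row.
  It is the direction, nonzero because \<open>P\<close> has a left inverse.\<close>

lemma type_one_of_kind:
  fixes M :: "('a::field ^ 'n::{finite,linorder} ^ 'm::{finite,linorder}) set"
  assumes "type_one M"
  shows "of_kind True M"
proof -
  obtain P :: "(('a, 'm) vec, 'm) vec" and A where P: "invertible P"
    and M: "M = translate ((\<lambda>X. P ** X) ` first_row_matrices) A"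
    using assms by (auto simp: type_one_def)
  obtain P' where P': "P' ** P = mat 1" using P by (auto simp: invertible_def)
  define x where "x = column (Min UNIV) P"
  have mul: "P ** X = outer x (X $ Min UNIV)" if "X \<in> first_row_matrices" for X :: "(('a, 'n) vec, 'm) vec"
  proof -
    have "(\<Sum>k\<in>UNIV. P $ i $ k * X $ k $ j) = (\<Sum>k\<in>{Min UNIV}. P $ i $ k * X $ k $ j)" for i j
      using that by (intro sum.mono_neutral_right) (auto simp: first_row_matrices_def)
    then show ?thesis by (simp add: matrix_matrix_mult_def vec_eq_iff x_def column_def)
  qed
  have "outer x y = P ** (\<chi> i. if i = Min UNIV then y else 0)" for y :: "('a, 'n) vec"
    by (subst mul) (auto simp: first_row_matrices_def)
  moreover have "(\<chi> i. if i = Min UNIV then y else 0) \<in> first_row_matrices" for y :: "('a, 'n) vec"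
    by (auto simp: first_row_matrices_def)
  ultimately have "(\<lambda>X. P ** X) ` first_row_matrices = range (\<lambda>y :: ('a, 'n) vec. outer x y)"
    using mul by (auto simp: image_iff)
  then have "M = row_set x A"
    by (auto simp: M translate_def row_set_def image_image add.commute)
  moreover have "x \<noteq> 0"
  proof
    assume "x = 0"
    then have "(P' ** P) $ Min UNIV $ Min UNIV = 0"
      by (simp add: x_def matrix_matrix_mult_def column_def vec_eq_iff)
    then show False by (simp add: P' mat_def)
  qed
  ultimately show ?thesis by (auto simp: of_kind_def)
qed

text \<open>Dually, the direction is the first row of \<open>Q\<close>, nonzero because
  \<open>Q\<close> has a right inverse.\<close>

lemma type_two_of_kind:
  fixes M :: "('a::field ^ 'n::{finite,linorder} ^ 'm::{finite,linorder}) set"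
  assumes "type_two M"
  shows "of_kind False M"
proof -
  obtain Q :: "(('a, 'n) vec, 'n) vec" and A where Q: "invertible Q"
    and M: "M = translate ((\<lambda>X. X ** Q) ` first_column_matrices) A"
    using assms by (auto simp: type_two_def)
  obtain Q' where Q': "Q ** Q' = mat 1" using Q by (auto simp: invertible_def)
  define y where "y = Q $ Min UNIV"
  have mul: "X ** Q = outer (column (Min UNIV) X) y" if "X \<in> first_column_matrices" for X :: "(('a, 'n) vec, 'm) vec"
  proof -
    have "(\<Sum>k\<in>UNIV. X $ i $ k * Q $ k $ j) = (\<Sum>k\<in>{Min UNIV}. X $ i $ k * Q $ k $ j)" for i j
      using that by (intro sum.mono_neutral_right) (auto simp: first_column_matrices_def)
    then show ?thesis by (simp add: matrix_matrix_mult_def vec_eq_iff y_def column_def)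
  qed
  have "outer x y = (\<chi> i j. if j = Min UNIV then x $ i else 0) ** Q" for x :: "('a, 'm) vec"
    by (subst mul) (auto simp: first_column_matrices_def column_def)
  moreover have "(\<chi> i j. if j = Min UNIV then x $ i else 0) \<in> first_column_matrices" for x :: "('a, 'm) vec"
    by (auto simp: first_column_matrices_def)
  ultimately have "(\<lambda>X. X ** Q) ` first_column_matrices = range (\<lambda>x :: ('a, 'm) vec. outer x y)"
    using mul by (auto simp: image_iff)
  then have "M = col_set y A"
    by (auto simp: M translate_def col_set_def image_image add.commute)
  moreover have "y \<noteq> 0"
  proof
    assume "y = 0"
    then have "(Q ** Q') $ Min UNIV $ Min UNIV = 0"
      by (simp add: y_def matrix_matrix_mult_def)
    then show False by (simp add: Q' mat_def)
  qed
  ultimately show ?thesis by (auto simp: of_kind_def)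
qed

lemma different_types_of_kind:
  assumes "different_types M N"
  obtains b where "of_kind b M" "of_kind (\<not> b) N"
proof -
  have "of_kind True M \<and> of_kind (\<not> True) N \<or> of_kind False M \<and> of_kind (\<not> False) N"
    using assms by (auto simp: different_types_def dest: type_one_of_kind type_two_of_kind)
  then show ?thesis using that by blast
qed

section \<open>Translations and the final assembly\<close>

lemma translate_translate: "translate (translate S A) B = translate S (A + B)"
  by (auto simp: translate_def image_image add.assoc)

lemma translate_0: "translate S 0 = S"
  by (simp add: translate_def)

lemma adjacent_set_translate: "adjacent_set S \<Longrightarrow> adjacent_set (translate S A)"
  by (auto simp: adjacent_set_def translate_def adjacent_def)

text \<open>A larger adjacent set around the translate, moved back by \<open>- A\<close>, would
  enlarge \<open>S\<close>.\<close>

lemma maximal_set_translate: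
  assumes "maximal_set S"
  shows "maximal_set (translate S A)"
  unfolding maximal_set_def
proof (intro conjI notI)
  show "adjacent_set (translate S A)"
    using assms by (simp add: maximal_set_def adjacent_set_translate)
  assume "\<exists>T. adjacent_set T \<and> translate S A \<subset> T"
  then obtain T where T: "adjacent_set T" "translate S A \<subset> T" by blast
  then have "translate (translate S A) (- A) \<subset> translate T (- A)"
    unfolding translate_def by (intro image_strict_mono) (auto intro: inj_onI)
  then have "S \<subset> translate T (- A)"
    by (simp add: translate_translate translate_0)
  then show False
    using assms T(1) adjacent_set_translate by (auto simp: maximal_set_def)
qed

lemma type_one_translate: "type_one S \<Longrightarrow> type_one (translate S A)"
  and type_two_translate: "type_two T \<Longrightarrow> type_two (translate T A)"
  unfolding type_one_def type_two_def by (metis maximal_set_translate translate_translate)+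

lemma different_types_translate:
  "different_types M N \<Longrightarrow> different_types (translate M A) (translate N A)"
  unfolding different_types_def using type_one_translate type_two_translate by blast

theorem theorem5p9:
  fixes \<phi> :: "('a::{field,finite}) ^ ('n::{finite,linorder}) ^ ('m::{finite,linorder}) \<Rightarrow>
              ('b::{field,finite}) ^ ('q::{finite,linorder}) ^ ('p::{finite,linorder})"
  assumes "4 \<le> CARD('a)"
    and "CARD('a) \<le> CARD('b)"
    and "int CARD('b) \<le> (int CARD('a) - 1) * \<lceil>(real CARD('a) + 1) / 2\<rceil>"
    and "CARD('m) \<ge> 2" and "CARD('n) \<ge> 2" and "CARD('p) \<ge> 2" and "CARD('q) \<ge> 2"
    and "graph_hom \<phi>"
    and "degenerate \<phi>"
  shows "\<exists>(M :: ('b ^ ('q::{finite,linorder}) ^ ('p::{finite,linorder})) set) N R.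
           different_types M N \<and> 0 \<in> M \<and> 0 \<in> N \<and>
           range \<phi> \<subseteq> translate M R \<union> translate N R"
proof -
  interpret small_hom \<phi> by unfold_locales (use assms in auto)
  obtain A M N where MN: "different_types M N" and sub: "\<phi> ` unit_ball A \<subseteq> M \<union> N"
    and A: "\<phi> A \<in> M" "\<phi> A \<in> N"
    using \<open>degenerate \<phi>\<close> by (auto simp: degenerate_def)
  obtain b where b: "of_kind b M" "of_kind (\<not> b) N"
    using MN by (rule different_types_of_kind)
  have "\<phi> ` row_set w A \<subseteq> M \<or> \<phi> ` row_set w A \<subseteq> N" for w
  proof (rule adjacent_set_in_union[OF _ b _ A])
    show "adjacent_set (\<phi> ` row_set w A)"
      by (simp add: adjacent_set_image hom adjacent_set_row_set)
    show "\<phi> ` row_set w A \<subseteq> M \<union> N" using row_set_subset_unit_ball sub by blast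
  qed
  moreover have "\<phi> ` col_set w A \<subseteq> M \<or> \<phi> ` col_set w A \<subseteq> N" for w
  proof (rule adjacent_set_in_union[OF _ b _ A])
    show "adjacent_set (\<phi> ` col_set w A)"
      by (simp add: adjacent_set_image hom adjacent_set_col_set)
    show "\<phi> ` col_set w A \<subseteq> M \<union> N" using col_set_subset_unit_ball sub by blast
  qed
  ultimately have "\<phi> ` unit_ball A \<subseteq> M \<or> \<phi> ` unit_ball A \<subseteq> N"
    by (intro image_unit_ball_dichotomy[OF b])
  then have "range \<phi> \<subseteq> M \<union> N"
    using range_subset b by blast
  \<comment> \<open>The witness for \<open>R\<close> is \<open>\<phi> A\<close>: it lies in both
    sets, so moving them back by it makes both contain \<open>0\<close>.\<close>
  then have "range \<phi> \<subseteq> translate (translate M (- \<phi> A)) (\<phi> A) \<union> translate (translate N (- \<phi> A)) (\<phi> A)"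
    by (simp add: translate_translate translate_0)
  moreover have "0 \<in> translate M (- \<phi> A)" "0 \<in> translate N (- \<phi> A)"
    using A by (auto simp: translate_def image_iff)
  ultimately show ?thesis
    using different_types_translate[OF MN] by blast
qed

end
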